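(* Let $\{x_k\}$ be the sequence generated by the adaptive prox-convex algorithm described in the context, let $x^\star$ be a limit point of $\{x_k\}$, and write $\mathcal G_{Q_k}(x_k):=Q_k(x_k-x_{k+1})$. Assume that the metric step-size error bound holds at $x^\star$: there exist $\kappa>0$, a neighborhood $\mathcal U$ of $x^\star$ and an index $K$ such that for all $k\ge K$, $$x_k\in\mathcal U,\qquad \|x_k-x^\star\|\le\kappa\,\|\mathcal G_{Q_k}(x_k)\| .$$ Let $0<\underline q\le\overline q<\infty$ be uniform spectral bounds, $\underline q\,I\preceq Q_k\preceq\overline q\,I$ for all metrics $Q_k$ used by the algorithm, and assume $\underline q>L_U/(2-\alpha_1)$. Set $F^\star:=F(x^\star)$. Then all steps are accepted, and $$F(x_{k+1})-F^\star\ \le\ q^\star\,(F(x_k)-F^\star)\qquad\text{for all }k\ge K,$$ with $$q^\star:=1-\min\Big\{1,\ \frac{2-\frac{L_U}{\underline q}}{\overline q\,(2+L_L)\,\bar\kappa^2}\Big\}\in[0,1),\qquad\bar\kappa:=\max\{1,\kappa\}.$$ Consequently, $\{F(x_k)\}$ converges $Q$-linearly to $F(x^\star)$.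
   Context: **Problem.** $F(x)=g(x)+h(C(x))+s(R(x))$ on $\mathbb R^m$, where $g:\mathbb R^m\to\mathbb R\cup\{+\infty\}$ is proper, closed, convex; $h:\mathbb R^d\to\mathbb R$ is finite-valued, closed, convex; $C:\mathbb R^m\to\mathbb R^d$ and $s:\mathbb R^n\to\mathbb R$ are $\mathcal C^1$; $R=(r_1,\dots,r_n)$ with each $r_i:\mathbb R^m\to\mathbb R$ finite-valued, closed, convex. $\|\cdot\|$ is the Euclidean norm on vectors and the spectral norm on matrices; $\|u\|_Q^2:=u^\top Qu$. **Standing assumptions.** (1) Monotone-or-smooth: for each $\bar x\in\operatorname{dom}F$ there is a neighborhood $W$ of $R(\bar x)$ such that, for every $i$, if $r_i$ is not $\mathcal C^1$ on any neighborhood of $\bar x$ then $\nabla_i s(z)\ge0$ for all $z\in W$. (2) $x_0\in\operatorname{dom}F$ and $\mathcal X_0:=\{x\in\operatorname{dom}F: F(x)\le F(x_0)\}$ is nonempty and compact. (3) $h$ is $L_h$-Lipschitz; $C$ has $\beta_C$-Lipschitz Jacobian; $s$ has $\beta_s$-Lipschitz gradient; each $r_i$ is $L_{r_i}$-Lipschitz, and $L_R:=\|(L_{r_1},\dots,L_{r_n})\|_2$. (4) Let $\mathcal I^-$ be the set of indices $i$ with $\nabla_i s(R(x))<0$ for some $x\in\mathcal X_0$. If $\mathcal I^-\ne\emptyset$, then $\|\nabla s(y)\|\le L_s$ for all $y\in\{R(x):F(x)\le F(x_0)\}$, and each $r_i$, $i\in\mathcal I^-$, is $\mathcal C^1$ with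 $\beta_{r_i}$-Lipschitz gradient; $\beta_R:=(\sum_{i\in\mathcal I^-}\beta_{r_i}^2)^{1/2}$. If $\mathcal I^-=\emptyset$, then $\beta_R=0$ and $L_s\beta_R$ is read as $0$. **Constants.** $L_U:=L_h\beta_C+L_R^2\beta_s$, $L_L:=L_U+L_s\beta_R$. **Model.** For $x_k\in\mathcal X_0$, $$F(x;x_k)=g(x)+h\big(C(x_k)+\nabla C(x_k)(x-x_k)\big)+s(R(x_k))+\sum_{i=1}^n\nabla_i s(R(x_k))\,\Phi_i(x;x_k),$$ where $\Phi_i(x;x_k)=r_i(x)-r_i(x_k)$ if $\nabla_i s(R(x_k))\ge0$, and $\Phi_i(x;x_k)=\nabla r_i(x_k)^\top(x-x_k)$ if $\nabla_i s(R(x_k))<0$. $F(\cdot;x_k)$ is convex. The proximal model is $F_{Q}(x;x_k)=F(x;x_k)+\tfrac12\|x-x_k\|_{Q}^2$. **Algorithm.** Input $x_0$, $\mu_0>0$, $\mu_{\min}>0$, $0<\alpha_1<\alpha_2<1$, $\nu_{\rm inc}>1>\nu_{\rm dec}>0$, tolerance $\epsilon_{\rm term}\ge0$. For $k=0,1,2,\dots$: build a symmetric matrix $H_k^+\succeq0$. Repeat: set $Q_k=\mu_kI+H_k^+$; $x_k^+=\arg\min_xF_{Q_k}(x;x_k)$; $\mathrm{Pred}_k=F(x_k)-F_{Q_k}(x_k^+;x_k)$; $\mathrm{Act}_k=F(x_k)-F(x_k^+)$; if $\mathrm{Pred}_k=0$ or $\|Q_k(x_k-x_k^+)\|\le\epsilon_{\rm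 term}$, terminate and return $x_k$; set $\rho_k=\mathrm{Act}_k/\mathrm{Pred}_k$; if $\rho_k<\alpha_1$ (rejection), set $\mu_k\leftarrow\nu_{\rm inc}\mu_k$; until $\rho_k\ge\alpha_1$ (acceptance). Then $x_{k+1}=x_k^+$, and $\mu_{k+1}=\max\{\mu_{\min},\nu_{\rm dec}\mu_k\}$ if $\rho_k>\alpha_2$, $\mu_{k+1}=\mu_k$ otherwise. The statement concerns runs producing an infinite sequence $\{x_k\}$; $Q_k$ in $\mathcal G_{Q_k}(x_k)$ is the metric at acceptance. *)

theory Defs
  imports "HOL-Analysis.Analysis"
begin

section \<open>Extended-real-valued functions\<close>

definition effective_dom :: "('a \<Rightarrow> ereal) \<Rightarrow> 'a set" where
  "effective_dom f = {x. f x < \<infinity>}"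

definition proper_fun :: "('a \<Rightarrow> ereal) \<Rightarrow> bool" where
  "proper_fun f \<longleftrightarrow> (\<forall>x. f x \<noteq> -\<infinity>) \<and> effective_dom f \<noteq> {}"

text \<open>The library's \<open>epigraph\<close> is for real-valued functions only; this is the same notion for
  extended-real-valued ones. "Closed" and "convex" mean that the epigraph is.\<close>

definition ereal_epigraph :: "('a \<Rightarrow> ereal) \<Rightarrow> ('a \<times> real) set" where
  "ereal_epigraph f = {xt. f (fst xt) \<le> ereal (snd xt)}"

section \<open>Differentiability\<close>

text \<open>To be used with open \<open>S\<close>.\<close>

definition C1_on :: "('a::real_normed_vector \<Rightarrow> 'b::real_normed_vector) \<Rightarrow> 'a set \<Rightarrow> bool" where
  "C1_on f S \<longleftrightarrow>
     (\<exists>f' :: 'a \<Rightarrow> 'a \<Rightarrow>\<^sub>L 'b.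
        (\<forall>x\<in>S. (f has_derivative blinfun_apply (f' x)) (at x)) \<and> continuous_on S f')"

definition grad :: "('a::real_inner \<Rightarrow> real) \<Rightarrow> 'a \<Rightarrow> 'a" where
  "grad f x = (THE D. GDERIV f x :> D)"

section \<open>Positive semidefinite matrices\<close>

definition psd_matrix :: "real^'m^'m \<Rightarrow> bool" where
  "psd_matrix A \<longleftrightarrow> transpose A = A \<and> (\<forall>v. 0 \<le> v \<bullet> (A *v v))"

definition loewner_le :: "real^'m^'m \<Rightarrow> real^'m^'m \<Rightarrow> bool"  (infix "\<preceq>\<^sub>L" 50) where
  "A \<preceq>\<^sub>L B \<longleftrightarrow> psd_matrix (B - A)"

section \<open>The objective and its convex model\<close>

definition R_map :: "('n \<Rightarrow> real^'m \<Rightarrow> real) \<Rightarrow> real^'m \<Rightarrow> real^'n" where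
  "R_map r x = (\<chi> i. r i x)"

definition objective ::
  "(real^'m \<Rightarrow> ereal) \<Rightarrow> (real^'d \<Rightarrow> real) \<Rightarrow> (real^'m \<Rightarrow> real^'d) \<Rightarrow> (real^'n \<Rightarrow> real)
    \<Rightarrow> ('n \<Rightarrow> real^'m \<Rightarrow> real) \<Rightarrow> real^'m \<Rightarrow> ereal" where
  "objective g h C s r x = g x + ereal (h (C x)) + ereal (s (R_map r x))"

definition sublevel ::
  "(real^'m \<Rightarrow> ereal) \<Rightarrow> (real^'d \<Rightarrow> real) \<Rightarrow> (real^'m \<Rightarrow> real^'d) \<Rightarrow> (real^'n \<Rightarrow> real)
    \<Rightarrow> ('n \<Rightarrow> real^'m \<Rightarrow> real) \<Rightarrow> real^'m \<Rightarrow> (real^'m) set" where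
  "sublevel g h C s r x0 =
     {x \<in> effective_dom (objective g h C s r). objective g h C s r x \<le> objective g h C s r x0}"

definition Phi ::
  "(real^'n \<Rightarrow> real) \<Rightarrow> ('n \<Rightarrow> real^'m \<Rightarrow> real) \<Rightarrow> real^'m \<Rightarrow> 'n \<Rightarrow> real^'m \<Rightarrow> real" where
  "Phi s r xk i x =
     (if grad s (R_map r xk) $ i \<ge> 0 then r i x - r i xk else grad (r i) xk \<bullet> (x - xk))"

definition convex_model ::
  "(real^'m \<Rightarrow> ereal) \<Rightarrow> (real^'d \<Rightarrow> real) \<Rightarrow> (real^'m \<Rightarrow> real^'d) \<Rightarrow> (real^'n \<Rightarrow> real)
    \<Rightarrow> ('n \<Rightarrow> real^'m \<Rightarrow> real) \<Rightarrow> real^'m \<Rightarrow> real^'m \<Rightarrow> ereal" where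
  "convex_model g h C s r xk x =
     g x + ereal (h (C xk + jacobian C (at xk) *v (x - xk))) + ereal (s (R_map r xk))
       + ereal (\<Sum>i\<in>UNIV. grad s (R_map r xk) $ i * Phi s r xk i x)"

definition prox_model ::
  "(real^'m \<Rightarrow> ereal) \<Rightarrow> (real^'d \<Rightarrow> real) \<Rightarrow> (real^'m \<Rightarrow> real^'d) \<Rightarrow> (real^'n \<Rightarrow> real)
    \<Rightarrow> ('n \<Rightarrow> real^'m \<Rightarrow> real) \<Rightarrow> real^'m^'m \<Rightarrow> real^'m \<Rightarrow> real^'m \<Rightarrow> ereal" where
  "prox_model g h C s r Q xk x =
     convex_model g h C s r xk x + ereal (1 / 2 * ((x - xk) \<bullet> (Q *v (x - xk))))"

section \<open>Problem assumptions\<close>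

definition prox_convex_problem ::
  "(real^'m \<Rightarrow> ereal) \<Rightarrow> (real^'d \<Rightarrow> real) \<Rightarrow> (real^'m \<Rightarrow> real^'d) \<Rightarrow> (real^'n \<Rightarrow> real)
    \<Rightarrow> ('n \<Rightarrow> real^'m \<Rightarrow> real) \<Rightarrow> bool" where
  "prox_convex_problem g h C s r \<longleftrightarrow>
     proper_fun g \<and> closed (ereal_epigraph g) \<and> convex (ereal_epigraph g) \<and>
     closed (epigraph UNIV h) \<and> convex_on UNIV h \<and>
     C1_on C UNIV \<and> C1_on s UNIV \<and>
     (\<forall>i. closed (epigraph UNIV (r i)) \<and> convex_on UNIV (r i))"

definition monotone_or_smooth ::
  "(real^'m \<Rightarrow> ereal) \<Rightarrow> (real^'d \<Rightarrow> real) \<Rightarrow> (real^'m \<Rightarrow> real^'d) \<Rightarrow> (real^'n \<Rightarrow> real)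
    \<Rightarrow> ('n \<Rightarrow> real^'m \<Rightarrow> real) \<Rightarrow> bool" where
  "monotone_or_smooth g h C s r \<longleftrightarrow>
     (\<forall>xb \<in> effective_dom (objective g h C s r).
        \<exists>W. open W \<and> R_map r xb \<in> W \<and>
          (\<forall>i. \<not> (\<exists>V. open V \<and> xb \<in> V \<and> C1_on (r i) V) \<longrightarrow> (\<forall>z\<in>W. grad s z $ i \<ge> 0)))"

definition neg_indices ::
  "(real^'m \<Rightarrow> ereal) \<Rightarrow> (real^'d \<Rightarrow> real) \<Rightarrow> (real^'m \<Rightarrow> real^'d) \<Rightarrow> (real^'n \<Rightarrow> real)
    \<Rightarrow> ('n \<Rightarrow> real^'m \<Rightarrow> real) \<Rightarrow> real^'m \<Rightarrow> 'n set" where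
  "neg_indices g h C s r x0 = {i. \<exists>x \<in> sublevel g h C s r x0. grad s (R_map r x) $ i < 0}"

section \<open>The adaptive prox-convex algorithm\<close>

definition pred_decrease ::
  "(real^'m \<Rightarrow> ereal) \<Rightarrow> (real^'d \<Rightarrow> real) \<Rightarrow> (real^'m \<Rightarrow> real^'d) \<Rightarrow> (real^'n \<Rightarrow> real)
    \<Rightarrow> ('n \<Rightarrow> real^'m \<Rightarrow> real) \<Rightarrow> real^'m^'m \<Rightarrow> real^'m \<Rightarrow> real^'m \<Rightarrow> ereal" where
  "pred_decrease g h C s r Q xk xp = objective g h C s r xk - prox_model g h C s r Q xk xp"

definition act_decrease ::
  "(real^'m \<Rightarrow> ereal) \<Rightarrow> (real^'d \<Rightarrow> real) \<Rightarrow> (real^'m \<Rightarrow> real^'d) \<Rightarrow> (real^'n \<Rightarrow> real)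
    \<Rightarrow> ('n \<Rightarrow> real^'m \<Rightarrow> real) \<Rightarrow> real^'m \<Rightarrow> real^'m \<Rightarrow> ereal" where
  "act_decrease g h C s r xk xp = objective g h C s r xk - objective g h C s r xp"

definition decrease_ratio ::
  "(real^'m \<Rightarrow> ereal) \<Rightarrow> (real^'d \<Rightarrow> real) \<Rightarrow> (real^'m \<Rightarrow> real^'d) \<Rightarrow> (real^'n \<Rightarrow> real)
    \<Rightarrow> ('n \<Rightarrow> real^'m \<Rightarrow> real) \<Rightarrow> real^'m^'m \<Rightarrow> real^'m \<Rightarrow> real^'m \<Rightarrow> ereal" where
  "decrease_ratio g h C s r Q xk xp =
     act_decrease g h C s r xk xp / pred_decrease g h C s r Q xk xp"

text \<open>The metric \<open>Q\<^sub>k = \<mu>\<^sub>k I + H\<^sub>k\<^sup>+\<close>; \<open>mat c\<close> is the matrix \<open>c I\<close>.\<close>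

definition prox_metric :: "real \<Rightarrow> real^'m^'m \<Rightarrow> real^'m^'m" where
  "prox_metric \<mu> H = mat \<mu> + H"

text \<open>A run with infinitely many outer iterations. Outer iteration \<open>k\<close> makes the passes
  \<open>j = 0, \<dots>, N k\<close> through the repeat loop: passes \<open>j < N k\<close> are rejected and pass \<open>N k\<close> is accepted.
  \<open>\<mu> k j\<close> and \<open>z k j\<close> are the proximal parameter and the trial point \<open>x\<^sub>k\<^sup>+\<close> in pass \<open>j\<close>.
  No pass meets the termination test.\<close>

definition prox_convex_run ::
  "(real^'m \<Rightarrow> ereal) \<Rightarrow> (real^'d \<Rightarrow> real) \<Rightarrow> (real^'m \<Rightarrow> real^'d) \<Rightarrow> (real^'n \<Rightarrow> real)
    \<Rightarrow> ('n \<Rightarrow> real^'m \<Rightarrow> real) \<Rightarrow> real^'m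
    \<Rightarrow> real \<Rightarrow> real \<Rightarrow> real \<Rightarrow> real \<Rightarrow> real \<Rightarrow> real \<Rightarrow> real
    \<Rightarrow> (nat \<Rightarrow> real^'m) \<Rightarrow> (nat \<Rightarrow> real^'m^'m) \<Rightarrow> (nat \<Rightarrow> nat)
    \<Rightarrow> (nat \<Rightarrow> nat \<Rightarrow> real) \<Rightarrow> (nat \<Rightarrow> nat \<Rightarrow> real^'m) \<Rightarrow> bool" where
  "prox_convex_run g h C s r x0 \<mu>0 \<mu>min \<alpha>1 \<alpha>2 \<nu>inc \<nu>dec \<epsilon>term x H N \<mu> z \<longleftrightarrow>
     x 0 = x0 \<and> \<mu> 0 0 = \<mu>0 \<and>
     (\<forall>k. psd_matrix (H k)) \<and>
     (\<forall>k. \<forall>j\<le>N k.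
        is_arg_min (prox_model g h C s r (prox_metric (\<mu> k j) (H k)) (x k)) (\<lambda>_. True) (z k j) \<and>
        \<not> (pred_decrease g h C s r (prox_metric (\<mu> k j) (H k)) (x k) (z k j) = 0 \<or>
           norm (prox_metric (\<mu> k j) (H k) *v (x k - z k j)) \<le> \<epsilon>term)) \<and>
     (\<forall>k. \<forall>j<N k.
        decrease_ratio g h C s r (prox_metric (\<mu> k j) (H k)) (x k) (z k j) < ereal \<alpha>1 \<and>
        \<mu> k (Suc j) = \<nu>inc * \<mu> k j) \<and>
     (\<forall>k. decrease_ratio g h C s r (prox_metric (\<mu> k (N k)) (H k)) (x k) (z k (N k)) \<ge> ereal \<alpha>1 \<and>
        x (Suc k) = z k (N k) \<and>
        \<mu> (Suc k) 0 =
          (if decrease_ratio g h C s r (prox_metric (\<mu> k (N k)) (H k)) (x k) (z k (N k)) > ereal \<alpha>2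
           then max \<mu>min (\<nu>dec * \<mu> k (N k)) else \<mu> k (N k)))"

section \<open>Q-linear convergence\<close>

definition converges_Q_linearly :: "(nat \<Rightarrow> 'a::metric_space) \<Rightarrow> 'a \<Rightarrow> bool" where
  "converges_Q_linearly a l \<longleftrightarrow>
     a \<longlonglongrightarrow> l \<and>
     (\<exists>q. 0 < q \<and> q < 1 \<and> (\<forall>\<^sub>F k in sequentially. dist (a (Suc k)) l \<le> q * dist (a k) l))"

end

theory Submission
  imports Defs
begin

text \<open>Let \<open>D\<close> be the squared length of the step from \<open>x k\<close> to \<open>x (Suc k)\<close> in the metric \<open>Q\<close> of that step, and put
  \<open>A = 2 - L_U / q_lo\<close> and \<open>B = q_hi (2 + L_L) \<kappa>bar\<^sup>2\<close>. The rate \<open>1 - min 1 (A / B)\<close> results from two estimates: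
  the step decreases the objective by at least \<open>A / 2 D\<close>, and after the step the objective exceeds its
  value at the limit point by at most \<open>(B - A) / 2 D\<close>. Eliminating \<open>D\<close> gives the contraction
  (\<open>linear_rate_of_step_estimates\<close>).

  Both estimates come from the three-point inequality \<open>prox_three_point\<close>: the proximal model grows
  quadratically, with the full metric as modulus, away from its minimizer. Comparing the minimizer
  with the current point yields the decrease, and also the acceptance test
  (\<open>prox_step_estimates\<close>); comparing it with the limit point yields the gap
  (\<open>prox_step_gap\<close>), where the error bound replaces the distance to the limit point by \<open>Q\<close> applied to the
  step, and \<open>norm_image_le_quadratic_form\<close> turns the latter into \<open>D\<close>.

  To pass between model and objective one needs that the model overestimates the objective up to
  \<open>L_U / 2\<close> times the squared distance (\<open>composite_le_model\<close>) and underestimates it up to \<open>L_L / 2\<close> times the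
  squared distance (\<open>model_le_composite\<close>). The two constants differ because linearizing a convex
  \<open>r i\<close> under a negative weight errs in one direction only.

  Every trial step is accepted, so the values decrease and the iterates remain in the initial
  sublevel set, where the constants are valid. The objective is lower semicontinuous, so its
  value at the limit point is finite and below all values along the run; hence the
  contraction of the gaps is convergence of the values.\<close>

section \<open>Taylor remainders and gradients\<close>

text \<open>The remainder along the segment, \<open>\<phi> t = f (x + t d) - t f' x d\<close>, has a derivative of norm at most
  \<open>\<beta> t \<parallel>d\<parallel>\<^sup>2\<close>, which is the derivative of \<open>\<beta> / 2 \<parallel>d\<parallel>\<^sup>2 t\<^sup>2\<close>; integrating over \<open>[0, 1]\<close> gives the factor
  \<open>\<beta> / 2\<close>. Stating it for vector-valued \<open>f\<close> and a bare derivative covers the inner map \<open>C\<close>, the outer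
  function \<open>s\<close> and the \<open>r i\<close> at once.\<close>

lemma quadratic_remainder_bound:
  fixes f :: "'a::real_normed_vector \<Rightarrow> 'b::real_normed_vector"
  assumes deriv: "\<And>u. (f has_derivative f' u) (at u)"
    and lip: "\<And>u v w. norm (f' u w - f' v w) \<le> \<beta> * norm (u - v) * norm w"
  shows "norm (f y - f x - f' x (y - x)) \<le> \<beta> / 2 * (norm (y - x))\<^sup>2"
proof -
  define d where "d = y - x"
  interpret bounded_linear "f' x"
    using deriv by (rule has_derivative_bounded_linear)
  define \<phi> where "\<phi> t = f (x + t *\<^sub>R d) - t *\<^sub>R f' x d" for t :: real
  define \<psi> where "\<psi> t = \<beta> / 2 * (norm d)\<^sup>2 * t\<^sup>2" for t :: real
  have \<phi>': "(\<phi> has_vector_derivative f' (x + t *\<^sub>R d) d - f' x d) (at t)" for t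
  proof -
    have "((\<lambda>t. f (x + t *\<^sub>R d)) has_derivative (\<lambda>h. f' (x + t *\<^sub>R d) (h *\<^sub>R d))) (at t)"
      by (rule has_derivative_compose[OF _ deriv]) (auto intro!: derivative_eq_intros)
    moreover have "f' (x + t *\<^sub>R d) (h *\<^sub>R d) = h *\<^sub>R f' (x + t *\<^sub>R d) d" for h
      using has_derivative_linear[OF deriv] by (simp add: linear_scale)
    ultimately have "((\<lambda>t. f (x + t *\<^sub>R d)) has_vector_derivative f' (x + t *\<^sub>R d) d) (at t)"
      by (simp add: has_vector_derivative_def)
    then show ?thesis
      unfolding \<phi>_def by (auto intro!: derivative_eq_intros)
  qed
  have \<psi>': "(\<psi> has_vector_derivative \<beta> * (norm d)\<^sup>2 * t) (at t)" for t
    unfolding \<psi>_def has_real_derivative_iff_has_vector_derivative[symmetric]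
    by (auto intro!: derivative_eq_intros)
  have "norm (\<phi> 1 - \<phi> 0) \<le> \<psi> 1 - \<psi> 0"
  proof (rule differentiable_bound_general[OF zero_less_one _ _ \<phi>' \<psi>'])
    show "continuous_on {0..1} \<phi>" "continuous_on {0..1} \<psi>"
      by (auto intro!: continuous_at_imp_continuous_on
          has_vector_derivative_continuous[OF \<phi>'] has_vector_derivative_continuous[OF \<psi>'])
    show "norm (f' (x + t *\<^sub>R d) d - f' x d) \<le> \<beta> * (norm d)\<^sup>2 * t" if "0 < t" for t
      using lip[of "x + t *\<^sub>R d" d x] that by (simp add: power2_eq_square algebra_simps)
  qed
  then show ?thesis
    by (simp add: \<phi>_def \<psi>_def d_def algebra_simps)
qed

text \<open>The gradient is a definite description, so it needs existence and uniqueness: the Riesz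
  representative of the derivative, obtained as its adjoint applied to \<open>1\<close>, provides both.\<close>

lemma gderiv_grad:
  assumes "f differentiable (at x)"
  shows "GDERIV f x :> grad (f :: 'a::euclidean_space \<Rightarrow> real) x"
proof -
  obtain f' where f': "(f has_derivative f') (at x)"
    using assms by (auto simp: differentiable_def)
  then have "linear f'"
    by (rule has_derivative_linear)
  then have "f' = (\<lambda>h. inner h (adjoint f' 1))"
    by (simp add: adjoint_works fun_eq_iff)
  then have ex: "GDERIV f x :> adjoint f' 1"
    using f' unfolding gderiv_def by simp
  have "D = adjoint f' 1" if "GDERIV f x :> D" for D
  proof -
    have "(\<lambda>h. inner h D) = (\<lambda>h. inner h (adjoint f' 1))"
      using that ex unfolding gderiv_def by (rule has_derivative_unique)
    then show ?thesis
      using vector_eq_ldot[of D "adjoint f' 1"] by (simp add: fun_eq_iff)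
  qed
  with ex show ?thesis
    unfolding grad_def by (rule theI)
qed

lemma C1_on_UNIV_differentiable: "C1_on f UNIV \<Longrightarrow> f differentiable (at x)"
  by (auto simp: C1_on_def differentiable_def)

lemma C1_on_UNIV_continuous: "C1_on f UNIV \<Longrightarrow> continuous_on UNIV f"
  by (intro continuous_at_imp_continuous_on ballI differentiable_imp_continuous_within
      C1_on_UNIV_differentiable)

lemma lipschitz_grad_remainder_bound:
  fixes f :: "'a::euclidean_space \<Rightarrow> real"
  assumes diff: "\<And>u. f differentiable (at u)" and lip: "\<beta>-lipschitz_on UNIV (grad f)"
  shows "\<bar>f y - f x - grad f x \<bullet> (y - x)\<bar> \<le> \<beta> / 2 * (norm (y - x))\<^sup>2"
proof -
  have "norm (f y - f x - (y - x) \<bullet> grad f x) \<le> \<beta> / 2 * (norm (y - x))\<^sup>2"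
  proof (rule quadratic_remainder_bound)
    show "(f has_derivative (\<lambda>h. h \<bullet> grad f u)) (at u)" for u
      using gderiv_grad[OF diff] by (simp add: gderiv_def)
    show "norm (w \<bullet> grad f u - w \<bullet> grad f v) \<le> \<beta> * norm (u - v) * norm w" for u v w
    proof -
      have "norm (w \<bullet> grad f u - w \<bullet> grad f v) \<le> norm w * norm (grad f u - grad f v)"
        by (metis Cauchy_Schwarz_ineq2 inner_diff_right real_norm_def)
      also have "\<dots> \<le> norm w * (\<beta> * norm (u - v))"
        using lipschitz_onD[OF lip, of u v] by (intro mult_left_mono) (auto simp: dist_norm)
      finally show ?thesis
        by (simp add: mult_ac)
    qed
  qed
  then show ?thesis
    by (simp add: inner_commute)
qed

lemma convex_on_comp_affine:
  assumes "convex_on UNIV f" "linear L"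
  shows "convex_on UNIV (\<lambda>x. f (a + L (x - b)))"
proof (rule convex_onI)
  fix t :: real and x y assume "0 < t" "t < 1"
  interpret linear L by fact
  have "a + L (((1 - t) *\<^sub>R x + t *\<^sub>R y) - b) = (1 - t) *\<^sub>R (a + L (x - b)) + t *\<^sub>R (a + L (y - b))"
    by (simp add: add diff scale algebra_simps)
  then show "f (a + L (((1 - t) *\<^sub>R x + t *\<^sub>R y) - b))
      \<le> (1 - t) * f (a + L (x - b)) + t * f (a + L (y - b))"
    using convex_onD[OF assms(1), of t] \<open>0 < t\<close> \<open>t < 1\<close> by simp
qed simp

text \<open>The restriction of \<open>f\<close> to the line through \<open>x\<close> and \<open>y\<close> is a convex function of one real variable
  with derivative \<open>grad f x \<bullet> (y - x)\<close> at \<open>0\<close>, so it lies above its tangent there.\<close>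

lemma convex_grad_inequality:
  fixes f :: "'a::euclidean_space \<Rightarrow> real"
  assumes conv: "convex_on UNIV f" and diff: "f differentiable (at x)"
  shows "grad f x \<bullet> (y - x) \<le> f y - f x"
proof -
  have "convex_on UNIV (\<lambda>t. f (x + (t - 0) *\<^sub>R (y - x)))"
    by (intro convex_on_comp_affine[OF conv]) simp
  moreover have "((\<lambda>t. f (x + (t - 0) *\<^sub>R (y - x))) has_field_derivative (y - x) \<bullet> grad f x) (at 0)"
  proof -
    let ?p = "\<lambda>t::real. x + (t - 0) *\<^sub>R (y - x)"
    have "(?p has_derivative (\<lambda>h. h *\<^sub>R (y - x))) (at 0)"
      by (auto intro!: derivative_eq_intros)
    moreover have "(f has_derivative (\<lambda>h. h \<bullet> grad f x)) (at (?p 0))"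
      using gderiv_grad[OF diff] by (simp add: gderiv_def)
    ultimately have "((\<lambda>t. f (?p t)) has_derivative (\<lambda>h. (h *\<^sub>R (y - x)) \<bullet> grad f x)) (at 0)"
      by (rule has_derivative_compose)
    then show ?thesis
      by (rule has_derivative_imp_has_field_derivative) simp
  qed
  ultimately show ?thesis
    using convex_on_imp_above_tangent[of UNIV "\<lambda>t. f (x + (t - 0) *\<^sub>R (y - x))" 0 1]
    by (simp add: inner_commute)
qed

section \<open>Quadratic forms with spectral bounds\<close>

lemma loewner_le_quadratic_form:
  assumes "A \<preceq>\<^sub>L B"
  shows "v \<bullet> (A *v v) \<le> v \<bullet> (B *v v)"
  using assms by (auto simp: loewner_le_def psd_matrix_def matrix_vector_mult_diff_rdistrib inner_diff_right
      dest: spec[of _ v])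

lemma mat_vector_mul: "mat c *v v = c *\<^sub>R (v :: real^'m)"
  by (simp add: vec_eq_iff matrix_vector_mult_def mat_def if_distrib if_distribR cong: if_cong)

lemma symmetric_matrix_inner:
  assumes "transpose Q = (Q :: real^'m^'m)"
  shows "v \<bullet> (Q *v w) = w \<bullet> (Q *v v)"
  by (metis assms dot_lmul_matrix inner_commute vector_transpose_matrix)

lemma spectral_bounds:
  fixes Q :: "real^'m^'m"
  assumes lo: "mat a \<preceq>\<^sub>L Q" and hi: "Q \<preceq>\<^sub>L mat b"
  shows "transpose Q = Q"
    and "a * (norm v)\<^sup>2 \<le> v \<bullet> (Q *v v)"
    and "v \<bullet> (Q *v v) \<le> b * (norm v)\<^sup>2"
proof -
  have t: "transpose (A - B) = transpose A - transpose B" for A B :: "real^'m^'m"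
    by (simp add: transpose_def vec_eq_iff)
  show "transpose Q = Q"
    using lo by (simp add: loewner_le_def psd_matrix_def t)
  show "a * (norm v)\<^sup>2 \<le> v \<bullet> (Q *v v)" "v \<bullet> (Q *v v) \<le> b * (norm v)\<^sup>2"
    using loewner_le_quadratic_form[OF lo, of v] loewner_le_quadratic_form[OF hi, of v]
    by (simp_all add: mat_vector_mul power2_norm_eq_inner)
qed

text \<open>This replaces a factor \<open>b\<^sup>2\<close>, which bounding \<open>Q v\<close> by the norm of \<open>v\<close> would give, by a factor \<open>b\<close> in
  front of the metric norm. It expresses that the form is nonnegative at \<open>v - Q v / b\<close>, where \<open>1 / b\<close>
  is the best multiple of \<open>Q v\<close> to subtract.\<close>

lemma norm_image_le_quadratic_form:
  fixes Q :: "real^'m^'m"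
  assumes sym: "transpose Q = Q" and pos: "\<And>v. 0 \<le> v \<bullet> (Q *v v)"
    and hi: "\<And>v. v \<bullet> (Q *v v) \<le> b * (norm v)\<^sup>2" and "0 < b"
  shows "(norm (Q *v v))\<^sup>2 \<le> b * (v \<bullet> (Q *v v))"
proof -
  define w where "w = v - (1 / b) *\<^sub>R (Q *v v)"
  have "w \<bullet> (Q *v w) = v \<bullet> (Q *v v) - 2 / b * (norm (Q *v v))\<^sup>2
      + (1 / b)\<^sup>2 * ((Q *v v) \<bullet> (Q *v (Q *v v)))"
    using symmetric_matrix_inner[OF sym, of v "Q *v v"]
    by (simp add: w_def matrix_vector_mult_diff_distrib matrix_vector_mult_scaleR inner_diff_left
        inner_diff_right power2_norm_eq_inner power2_eq_square[of "1 / b"] algebra_simps)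
  also have "\<dots> \<le> v \<bullet> (Q *v v) - 2 / b * (norm (Q *v v))\<^sup>2
      + (1 / b)\<^sup>2 * (b * (norm (Q *v v))\<^sup>2)"
    by (intro add_left_mono mult_left_mono hi) auto
  also have "\<dots> = v \<bullet> (Q *v v) - (norm (Q *v v))\<^sup>2 / b"
    using \<open>0 < b\<close> by (simp add: field_simps power2_eq_square)
  finally have "(norm (Q *v v))\<^sup>2 / b \<le> v \<bullet> (Q *v v)"
    using pos[of w] by linarith
  then show ?thesis
    using \<open>0 < b\<close> by (simp add: field_simps)
qed

section \<open>The three-point inequality for a proximal minimizer\<close>

lemma convex_ereal_epigraphD:
  assumes conv: "convex (ereal_epigraph g)" and inf: "\<And>x. g x \<noteq> -\<infinity>"
    and fin: "g x < \<infinity>" "g y < \<infinity>" and t: "0 \<le> t" "t \<le> 1"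
  shows "g ((1 - t) *\<^sub>R x + t *\<^sub>R y)
    \<le> ereal ((1 - t) * real_of_ereal (g x) + t * real_of_ereal (g y))"
proof -
  have "(u, real_of_ereal (g u)) \<in> ereal_epigraph g" if "g u < \<infinity>" for u
    using that inf[of u] by (cases "g u") (simp_all add: ereal_epigraph_def)
  then have "(1 - t) *\<^sub>R (x, real_of_ereal (g x)) + t *\<^sub>R (y, real_of_ereal (g y)) \<in> ereal_epigraph g"
    using fin t by (intro convexD[OF conv]) auto
  then show ?thesis
    by (simp add: ereal_epigraph_def)
qed

text \<open>The defect of a quadratic form from affinity along a segment; for a positive form this is strong
  convexity with the exact modulus.\<close>

lemma quadratic_form_segment:
  fixes Q :: "real^'m^'m"
  assumes "transpose Q = Q"
  shows "((1 - t) *\<^sub>R u + t *\<^sub>R v) \<bullet> (Q *v ((1 - t) *\<^sub>R u + t *\<^sub>R v))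
    = (1 - t) * (u \<bullet> (Q *v u)) + t * (v \<bullet> (Q *v v)) - t * (1 - t) * ((v - u) \<bullet> (Q *v (v - u)))"
proof -
  have "v \<bullet> (Q *v u) = u \<bullet> (Q *v v)"
    by (rule symmetric_matrix_inner[OF assms])
  then show ?thesis
    unfolding matrix_vector_mult_diff_distrib matrix_vector_right_distrib matrix_vector_mult_scaleR
      inner_diff_left inner_diff_right inner_add_left inner_add_right inner_scaleR_left inner_scaleR_right
    by (simp add: algebra_simps)
qed

text \<open>For positive \<open>Q\<close> the function \<open>g + m + 1/2 \<parallel>\<cdot> - c\<parallel>\<^sub>Q\<^sup>2\<close> is strongly convex with respect to the metric \<open>Q\<close>, hence it
  grows quadratically away from its minimizer \<open>z\<close>. The minimizer is compared with the point
  \<open>(1 - t) z + t y\<close>, and the growth term, which first appears with the factor \<open>1 - t\<close>, is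
  recovered in full as \<open>t\<close> tends to \<open>0\<close>.\<close>

lemma prox_three_point:
  fixes Q :: "real^'m^'m" and m :: "real^'m \<Rightarrow> real"
  assumes conv: "convex (ereal_epigraph g)" and inf: "\<And>x. g x \<noteq> -\<infinity>"
    and m: "convex_on UNIV m" and sym: "transpose Q = Q"
    and min: "\<And>y. g z + ereal (m z + 1/2 * ((z - c) \<bullet> (Q *v (z - c))))
                \<le> g y + ereal (m y + 1/2 * ((y - c) \<bullet> (Q *v (y - c))))"
    and y: "g y < \<infinity>"
  shows "g z < \<infinity>"
    and "real_of_ereal (g z) + m z + 1/2 * ((z - c) \<bullet> (Q *v (z - c))) + 1/2 * ((y - z) \<bullet> (Q *v (y - z)))
      \<le> real_of_ereal (g y) + m y + 1/2 * ((y - c) \<bullet> (Q *v (y - c)))"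
proof -
  define q where "q v = v \<bullet> (Q *v v)" for v
  define G where "G = (\<lambda>v. real_of_ereal (g v))"
  show gz: "g z < \<infinity>"
    using min[of y] y inf[of y] inf[of z] by (cases "g z"; cases "g y") auto
  have G: "g v = ereal (G v)" if "g v < \<infinity>" for v
    using that inf[of v] by (cases "g v") (simp_all add: G_def)
  have step: "G z + m z + 1/2 * q (z - c) + 1/2 * (1 - t) * q (y - z) \<le> G y + m y + 1/2 * q (y - c)"
    if t: "0 < t" "t < 1" for t
  proof -
    define w where "w = (1 - t) *\<^sub>R z + t *\<^sub>R y"
    have gw: "g w \<le> ereal ((1 - t) * G z + t * G y)"
      unfolding w_def G_def using t by (intro convex_ereal_epigraphD[OF conv inf gz y]) auto
    then have Gw: "G w \<le> (1 - t) * G z + t * G y" "g w < \<infinity>"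
      using inf[of w] by (cases "g w"; simp add: G_def)+
    have "w - c = (1 - t) *\<^sub>R (z - c) + t *\<^sub>R (y - c)" "y - z = (y - c) - (z - c)"
      by (simp_all add: w_def algebra_simps)
    then have qw: "q (w - c) = (1 - t) * q (z - c) + t * q (y - c) - t * (1 - t) * q (y - z)"
      unfolding q_def using quadratic_form_segment[OF sym] by metis
    have mw: "m w \<le> (1 - t) * m z + t * m y"
      unfolding w_def using convex_onD[OF m, of t] t by simp
    have "G z + m z + 1/2 * q (z - c) \<le> G w + m w + 1/2 * q (w - c)"
      using min[of w] by (simp add: G[OF gz] G[OF Gw(2)] q_def)
    also have "\<dots> \<le> (1 - t) * (G z + m z + 1/2 * q (z - c)) + t * (G y + m y + 1/2 * q (y - c))
        - 1/2 * (t * (1 - t) * q (y - z))"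
      using Gw(1) mw unfolding qw
      by (simp add: algebra_simps add_divide_distrib diff_divide_distrib)
    finally have "t * (G z + m z + 1/2 * q (z - c) + 1/2 * (1 - t) * q (y - z))
        \<le> t * (G y + m y + 1/2 * q (y - c))"
      by (simp add: algebra_simps add_divide_distrib diff_divide_distrib)
    then show ?thesis
      using t by simp
  qed
  have "((\<lambda>t. G z + m z + 1/2 * q (z - c) + 1/2 * (1 - t) * q (y - z))
      \<longlongrightarrow> G z + m z + 1/2 * q (z - c) + 1/2 * (1 - 0) * q (y - z)) (at_right 0)"
    by (intro tendsto_intros)
  moreover have "\<forall>\<^sub>F t in at_right 0. G z + m z + 1/2 * q (z - c) + 1/2 * (1 - t) * q (y - z)
      \<le> G y + m y + 1/2 * q (y - c)"
    using eventually_at_right_real[OF zero_less_one] by eventually_elim (intro step, auto)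
  ultimately have "G z + m z + 1/2 * q (z - c) + 1/2 * (1 - 0) * q (y - z) \<le> G y + m y + 1/2 * q (y - c)"
    by (rule tendsto_upperbound) simp
  then show "real_of_ereal (g z) + m z + 1/2 * ((z - c) \<bullet> (Q *v (z - c))) + 1/2 * ((y - z) \<bullet> (Q *v (y - z)))
      \<le> real_of_ereal (g y) + m y + 1/2 * ((y - c) \<bullet> (Q *v (y - c)))"
    by (simp add: G_def q_def)
qed

section \<open>The convex model as a two-sided approximation of the objective\<close>

text \<open>The objective and its model share the summand \<open>g\<close>, the only one that can be infinite. Separating
  the finite remainders \<open>composite_part\<close> and \<open>model_part\<close> from it lets every comparison between the two take
  place in the reals.\<close>

definition composite_part ::
  "(real^'d \<Rightarrow> real) \<Rightarrow> (real^'m \<Rightarrow> real^'d) \<Rightarrow> (real^'n \<Rightarrow> real) \<Rightarrow> ('n \<Rightarrow> real^'m \<Rightarrow> real)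
    \<Rightarrow> real^'m \<Rightarrow> real" where
  "composite_part h C s r x = h (C x) + s (R_map r x)"

definition model_part ::
  "(real^'d \<Rightarrow> real) \<Rightarrow> (real^'m \<Rightarrow> real^'d) \<Rightarrow> (real^'n \<Rightarrow> real) \<Rightarrow> ('n \<Rightarrow> real^'m \<Rightarrow> real)
    \<Rightarrow> real^'m \<Rightarrow> real^'m \<Rightarrow> real" where
  "model_part h C s r c x = h (C c + jacobian C (at c) *v (x - c)) + s (R_map r c)
     + (\<Sum>i\<in>UNIV. grad s (R_map r c) $ i * Phi s r c i x)"

lemma objective_eq: "objective g h C s r x = g x + ereal (composite_part h C s r x)"
  by (cases "g x") (simp_all add: objective_def composite_part_def)

lemma prox_model_eq:
  "prox_model g h C s r Q c x
    = g x + ereal (model_part h C s r c x + 1/2 * ((x - c) \<bullet> (Q *v (x - c))))"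
  by (cases "g x") (simp_all add: prox_model_def convex_model_def model_part_def)

lemma model_part_center: "model_part h C s r c c = composite_part h C s r c"
  by (auto simp: model_part_def composite_part_def Phi_def intro!: sum.neutral)

lemma convex_on_sum_fun:
  fixes f :: "'i \<Rightarrow> 'a::real_vector \<Rightarrow> real"
  assumes "\<And>i. i \<in> I \<Longrightarrow> convex_on S (f i)" "convex S"
  shows "convex_on S (\<lambda>x. \<Sum>i\<in>I. f i x)"
  using assms by (induction I rule: infinite_finite_induct) (auto simp: convex_on_const)

text \<open>The model is convex because a term \<open>r i\<close> that is not linearized carries a nonnegative weight; terms
  with negative weight are affine.\<close>

lemma convex_model_part:
  assumes h: "convex_on UNIV h" and r: "\<And>i. convex_on UNIV (r i)"
  shows "convex_on UNIV (model_part h C s r c)"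
proof -
  define a where "a i = grad s (R_map r c) $ i" for i
  have "convex_on UNIV (\<lambda>x. a i * Phi s r c i x)" for i
  proof (cases "a i \<ge> 0")
    case True
    then have "convex_on UNIV (\<lambda>x. a i * (r i x + - r i c))"
      by (intro convex_on_cmul convex_on_add r) (auto simp: convex_on_const)
    with True show ?thesis
      by (simp add: Phi_def a_def)
  next
    case False
    have "convex_on UNIV (\<lambda>x. a i * (grad (r i) c \<bullet> (x - c)))"
      by (rule convex_onI) (simp_all add: algebra_simps inner_simps)
    with False show ?thesis
      by (simp add: Phi_def a_def)
  qed
  moreover have "convex_on UNIV (\<lambda>x. h (C c + jacobian C (at c) *v (x - c)))"
    by (intro convex_on_comp_affine[OF h]) simp
  ultimately show ?thesis
    unfolding model_part_def a_def
    by (intro convex_on_add convex_on_sum_fun) (auto simp: convex_on_const)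
qed

lemma linearized_inner_map_bound:
  fixes C :: "real^'m \<Rightarrow> real^'d"
  assumes h_lip: "L_h-lipschitz_on UNIV h" and C1: "C1_on C UNIV"
    and C_lip: "\<And>u v. onorm (\<lambda>w. (jacobian C (at u) - jacobian C (at v)) *v w) \<le> \<beta>_C * norm (u - v)"
  shows "\<bar>h (C x) - h (C c + jacobian C (at c) *v (x - c))\<bar> \<le> L_h * \<beta>_C / 2 * (norm (x - c))\<^sup>2"
proof -
  have "norm (C x - C c - jacobian C (at c) *v (x - c)) \<le> \<beta>_C / 2 * (norm (x - c))\<^sup>2"
  proof (rule quadratic_remainder_bound)
    show "(C has_derivative (*v) (jacobian C (at u))) (at u)" for u
      using C1_on_UNIV_differentiable[OF C1] by (simp add: jacobian_works)
    show "norm (jacobian C (at u) *v w - jacobian C (at v) *v w) \<le> \<beta>_C * norm (u - v) * norm w" for u v w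
    proof -
      have "norm ((jacobian C (at u) - jacobian C (at v)) *v w)
          \<le> onorm (\<lambda>w. (jacobian C (at u) - jacobian C (at v)) *v w) * norm w"
        by (rule onorm) simp
      also have "\<dots> \<le> \<beta>_C * norm (u - v) * norm w"
        by (intro mult_right_mono C_lip) simp
      finally show ?thesis
        by (simp add: matrix_vector_mult_diff_rdistrib)
    qed
  qed
  then have "L_h * norm (C x - (C c + jacobian C (at c) *v (x - c))) \<le> L_h * (\<beta>_C / 2 * (norm (x - c))\<^sup>2)"
    using lipschitz_on_nonneg[OF h_lip] by (intro mult_left_mono) (simp_all add: algebra_simps)
  moreover have "\<bar>h (C x) - h (C c + jacobian C (at c) *v (x - c))\<bar>
      \<le> L_h * norm (C x - (C c + jacobian C (at c) *v (x - c)))"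
    using lipschitz_onD[OF h_lip] by (simp add: dist_norm)
  ultimately show ?thesis
    by simp
qed

lemma R_map_lipschitz:
  assumes "\<And>i. (L_r i)-lipschitz_on UNIV (r i)"
  shows "norm (R_map r x - R_map r y) \<le> norm (\<chi> i. L_r i) * norm (x - y)"
proof -
  have "L2_set (\<lambda>i. norm ((R_map r x - R_map r y) $ i)) UNIV
      \<le> L2_set (\<lambda>i. norm ((\<chi> i. L_r i) $ i) * norm (x - y)) UNIV"
    using lipschitz_onD[OF assms, of x y] lipschitz_on_nonneg[OF assms]
    by (intro L2_set_mono) (auto simp: R_map_def dist_norm)
  then show ?thesis
    by (simp add: norm_vec_def L2_set_left_distrib)
qed

lemma linearized_outer_function_bound:
  fixes s :: "real^'n \<Rightarrow> real"
  assumes C1: "C1_on s UNIV" and s_lip: "\<beta>_s-lipschitz_on UNIV (grad s)"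
    and r_lip: "\<And>i. (L_r i)-lipschitz_on UNIV (r i)"
  shows "\<bar>s (R_map r x) - s (R_map r c) - (\<Sum>i\<in>UNIV. grad s (R_map r c) $ i * (r i x - r i c))\<bar>
    \<le> (norm (\<chi> i. L_r i))\<^sup>2 * \<beta>_s / 2 * (norm (x - c))\<^sup>2"
proof -
  have "\<bar>s (R_map r x) - s (R_map r c) - grad s (R_map r c) \<bullet> (R_map r x - R_map r c)\<bar>
      \<le> \<beta>_s / 2 * (norm (R_map r x - R_map r c))\<^sup>2"
    by (rule lipschitz_grad_remainder_bound[OF C1_on_UNIV_differentiable[OF C1] s_lip])
  also have "\<dots> \<le> \<beta>_s / 2 * (norm (\<chi> i. L_r i) * norm (x - c))\<^sup>2"
    using lipschitz_on_nonneg[OF s_lip] R_map_lipschitz[where r = r, OF r_lip]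
    by (intro mult_left_mono power_mono) auto
  finally show ?thesis
    by (simp add: inner_vec_def R_map_def power_mult_distrib mult_ac)
qed

text \<open>Linearizing \<open>C\<close> and \<open>s\<close> costs the two curvature terms. Linearizing \<open>r i\<close> costs nothing in this
  direction: it happens only under a negative weight, and a convex function lies above its
  tangents.\<close>

lemma composite_le_model:
  fixes C :: "real^'m \<Rightarrow> real^'d" and s :: "real^'n \<Rightarrow> real"
  assumes h_lip: "L_h-lipschitz_on UNIV h" and C1_C: "C1_on C UNIV"
    and C_lip: "\<And>u v. onorm (\<lambda>w. (jacobian C (at u) - jacobian C (at v)) *v w) \<le> \<beta>_C * norm (u - v)"
    and C1_s: "C1_on s UNIV" and s_lip: "\<beta>_s-lipschitz_on UNIV (grad s)"
    and r_lip: "\<And>i. (L_r i)-lipschitz_on UNIV (r i)" and r_conv: "\<And>i. convex_on UNIV (r i)"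
    and r_diff: "\<And>i. grad s (R_map r c) $ i < 0 \<Longrightarrow> r i differentiable (at c)"
  shows "composite_part h C s r x \<le> model_part h C s r c x
    + (L_h * \<beta>_C + (norm (\<chi> i. L_r i))\<^sup>2 * \<beta>_s) / 2 * (norm (x - c))\<^sup>2"
proof -
  have "grad s (R_map r c) $ i * (r i x - r i c) \<le> grad s (R_map r c) $ i * Phi s r c i x" for i
    using convex_grad_inequality[OF r_conv r_diff, of i x]
    by (auto simp: Phi_def intro: mult_left_mono_neg)
  then have "(\<Sum>i\<in>UNIV. grad s (R_map r c) $ i * (r i x - r i c))
      \<le> (\<Sum>i\<in>UNIV. grad s (R_map r c) $ i * Phi s r c i x)"
    by (rule sum_mono)
  then show ?thesis
    using linearized_inner_map_bound[OF h_lip C1_C C_lip, of x c]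
      linearized_outer_function_bound[where r = r and x = x and c = c, OF C1_s s_lip r_lip]
    unfolding composite_part_def model_part_def add_divide_distrib distrib_right by linarith
qed

text \<open>In this direction the linearized \<open>r i\<close> do contribute: each is off by at most \<open>\<beta>_r i / 2 \<parallel>x - c\<parallel>\<^sup>2\<close>, with
  weight a component of the gradient of \<open>s\<close>. The Cauchy-Schwarz inequality over the index set turns
  the weighted sum into the product of \<open>L_s\<close> and the Euclidean norm of the \<open>\<beta>_r i\<close>.\<close>

lemma model_le_composite:
  fixes C :: "real^'m \<Rightarrow> real^'d" and s :: "real^'n \<Rightarrow> real"
  assumes h_lip: "L_h-lipschitz_on UNIV h" and C1_C: "C1_on C UNIV"
    and C_lip: "\<And>u v. onorm (\<lambda>w. (jacobian C (at u) - jacobian C (at v)) *v w) \<le> \<beta>_C * norm (u - v)"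
    and C1_s: "C1_on s UNIV" and s_lip: "\<beta>_s-lipschitz_on UNIV (grad s)"
    and r_lip: "\<And>i. (L_r i)-lipschitz_on UNIV (r i)"
    and neg: "\<And>i. grad s (R_map r c) $ i < 0 \<Longrightarrow> i \<in> I"
    and C1_r: "\<And>i. i \<in> I \<Longrightarrow> C1_on (r i) UNIV"
    and r_grad_lip: "\<And>i. i \<in> I \<Longrightarrow> (\<beta>_r i)-lipschitz_on UNIV (grad (r i))"
    and s_grad: "I \<noteq> {} \<Longrightarrow> norm (grad s (R_map r c)) \<le> L_s"
  shows "model_part h C s r c x \<le> composite_part h C s r x
    + (L_h * \<beta>_C + (norm (\<chi> i. L_r i))\<^sup>2 * \<beta>_s + L_s * sqrt (\<Sum>i\<in>I. (\<beta>_r i)\<^sup>2)) / 2 * (norm (x - c))\<^sup>2"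
proof -
  define a where "a i = grad s (R_map r c) $ i" for i
  define n where "n = (norm (x - c))\<^sup>2"
  have term_bound: "a i * Phi s r c i x - a i * (r i x - r i c) \<le> (if i \<in> I then \<bar>a i\<bar> * \<bar>\<beta>_r i\<bar> * (n / 2) else 0)" for i
  proof (cases "a i < 0")
    case True
    then have i: "i \<in> I"
      by (intro neg) (simp add: a_def)
    have "\<bar>r i x - r i c - grad (r i) c \<bullet> (x - c)\<bar> \<le> \<beta>_r i / 2 * n"
      unfolding n_def
      by (rule lipschitz_grad_remainder_bound[OF C1_on_UNIV_differentiable[OF C1_r[OF i]] r_grad_lip[OF i]])
    then have "- a i * (r i x - r i c - grad (r i) c \<bullet> (x - c)) \<le> - a i * (\<beta>_r i / 2 * n)"
      using True by (intro mult_left_mono) linarith+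
    moreover have "a i * Phi s r c i x - a i * (r i x - r i c)
        = - a i * (r i x - r i c - grad (r i) c \<bullet> (x - c))"
      using True by (simp add: Phi_def a_def right_diff_distrib)
    moreover have "- a i * (\<beta>_r i / 2 * n) = \<bar>a i\<bar> * \<bar>\<beta>_r i\<bar> * (n / 2)"
      using True lipschitz_on_nonneg[OF r_grad_lip[OF i]] by simp
    ultimately show ?thesis
      using i by simp
  qed (auto simp: Phi_def a_def n_def)
  have "(\<Sum>i\<in>UNIV. a i * Phi s r c i x) - (\<Sum>i\<in>UNIV. a i * (r i x - r i c))
      \<le> (\<Sum>i\<in>UNIV. if i \<in> I then \<bar>a i\<bar> * \<bar>\<beta>_r i\<bar> * (n / 2) else 0)"
    unfolding sum_subtractf[symmetric] by (intro sum_mono term_bound)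
  also have "\<dots> = (\<Sum>i\<in>I. \<bar>a i\<bar> * \<bar>\<beta>_r i\<bar>) * (n / 2)"
    by (simp add: sum.If_cases sum_distrib_right)
  also have "\<dots> \<le> (L_s * sqrt (\<Sum>i\<in>I. (\<beta>_r i)\<^sup>2)) * (n / 2)"
  proof (cases "I = {}")
    case False
    have "L2_set a I \<le> norm (grad s (R_map r c))"
      unfolding norm_vec_def L2_set_def a_def by (auto intro!: sum_mono2)
    then have "L2_set a I * L2_set \<beta>_r I \<le> L_s * L2_set \<beta>_r I"
      using s_grad[OF False] by (intro mult_right_mono) (auto simp: L2_set_nonneg)
    then have "(\<Sum>i\<in>I. \<bar>a i\<bar> * \<bar>\<beta>_r i\<bar>) \<le> L_s * sqrt (\<Sum>i\<in>I. (\<beta>_r i)\<^sup>2)"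
      using L2_set_mult_ineq[of a \<beta>_r I] by (simp add: L2_set_def)
    then show ?thesis
      by (intro mult_right_mono) (simp_all add: n_def)
  qed simp
  finally have "(\<Sum>i\<in>UNIV. grad s (R_map r c) $ i * Phi s r c i x)
      \<le> (\<Sum>i\<in>UNIV. grad s (R_map r c) $ i * (r i x - r i c))
        + L_s * sqrt (\<Sum>i\<in>I. (\<beta>_r i)\<^sup>2) / 2 * (norm (x - c))\<^sup>2"
    by (simp add: a_def n_def)
  then show ?thesis
    using linearized_inner_map_bound[OF h_lip C1_C C_lip, of x c]
      linearized_outer_function_bound[where r = r and x = x and c = c, OF C1_s s_lip r_lip]
    unfolding composite_part_def model_part_def add_divide_distrib distrib_right by linarith
qed

section \<open>Lower semicontinuity and rates of scalar sequences\<close>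

lemma continuous_composite_part:
  assumes h_lip: "L_h-lipschitz_on UNIV h" and C1_C: "C1_on C UNIV" and C1_s: "C1_on s UNIV"
    and r_lip: "\<And>i. (L_r i)-lipschitz_on UNIV (r i)"
  shows "continuous_on UNIV (composite_part h C s r)"
proof -
  have "continuous_on UNIV (\<lambda>x. h (C x))"
    using continuous_on_compose2[OF lipschitz_on_continuous_on[OF h_lip]] C1_on_UNIV_continuous[OF C1_C]
    by simp
  moreover have "continuous_on UNIV (R_map r)"
    unfolding R_map_def by (intro continuous_on_vec_lambda lipschitz_on_continuous_on[OF r_lip])
  then have "continuous_on UNIV (\<lambda>x. s (R_map r x))"
    using continuous_on_compose2[OF C1_on_UNIV_continuous[OF C1_s]] by simp
  ultimately show ?thesis
    unfolding composite_part_def by (rule continuous_on_add)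
qed

text \<open>Lower semicontinuity of \<open>g + f\<close> in the form used for limit points: the points \<open>(X n, c - f (X n))\<close> lie
  in the closed epigraph of \<open>g\<close> and converge.\<close>

lemma sublevel_limit:
  assumes g: "closed (ereal_epigraph g)" and f: "continuous_on UNIV f"
    and lim: "X \<longlonglongrightarrow> l" and le: "\<And>n. g (X n) + ereal (f (X n)) \<le> ereal c"
  shows "g l + ereal (f l) \<le> ereal c"
proof -
  have "(X n, c - f (X n)) \<in> ereal_epigraph g" for n
    using le[of n] by (cases "g (X n)") (auto simp: ereal_epigraph_def)
  moreover have "(\<lambda>n. f (X n)) \<longlonglongrightarrow> f l"
    by (rule continuous_on_tendsto_compose[OF f lim]) auto
  then have "(\<lambda>n. (X n, c - f (X n))) \<longlonglongrightarrow> (l, c - f l)"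
    by (intro tendsto_Pair[OF lim] tendsto_diff tendsto_const)
  ultimately have "(l, c - f l) \<in> ereal_epigraph g"
    using closed_sequentially[OF g] by meson
  then show ?thesis
    by (cases "g l") (auto simp: ereal_epigraph_def)
qed

text \<open>Think of \<open>D\<close> as the squared length of a step from value \<open>F\<close> to value \<open>F'\<close>. The decrease bounds \<open>D\<close> from
  above by \<open>2 (F - F') / A\<close>; inserted into the gap estimate, this makes the new gap at most \<open>(B - A) / A\<close> times
  the decrease, and solving for \<open>F'\<close> yields the rate \<open>1 - A / B\<close>. For \<open>B \<le> A\<close> the gap estimate alone says
  that the step has closed the gap.\<close>

lemma linear_rate_of_step_estimates:
  fixes A B D F F' Fmin :: real
  assumes "0 < A" "0 < B" "0 \<le> D"
    and dec: "F' \<le> F - A / 2 * D" and gap: "F' - Fmin \<le> (B - A) / 2 * D"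
  shows "F' - Fmin \<le> (1 - min 1 (A / B)) * (F - Fmin)"
proof (cases "B \<le> A")
  case True
  then have "min 1 (A / B) = 1"
    using \<open>0 < B\<close> by (simp add: min_def)
  moreover have "(B - A) / 2 * D \<le> 0"
    using True \<open>0 \<le> D\<close> by (simp add: mult_le_0_iff)
  ultimately show ?thesis
    using gap by simp
next
  case False
  have "A * (F' - Fmin) \<le> A * ((B - A) / 2 * D)"
    using gap \<open>0 < A\<close> by (intro mult_left_mono) auto
  also have "\<dots> = (B - A) * (A / 2 * D)"
    by simp
  also have "\<dots> \<le> (B - A) * (F - F')"
    using dec False by (intro mult_left_mono) auto
  finally have "B * (F' - Fmin) \<le> (B - A) * (F - Fmin)"
    by (simp add: algebra_simps)
  then have "F' - Fmin \<le> (1 - A / B) * (F - Fmin)"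
    using \<open>0 < B\<close> by (simp add: field_simps)
  then show ?thesis
    using False \<open>0 < B\<close> by (simp add: min_def field_simps)
qed

lemma converges_Q_linearlyI:
  fixes a :: "nat \<Rightarrow> real"
  assumes lower: "\<And>k. l \<le> a k" and q: "q < 1"
    and rate: "\<And>k. k \<ge> K \<Longrightarrow> a (Suc k) - l \<le> q * (a k - l)"
  shows "converges_Q_linearly a l"
proof -
  \<comment> \<open>Q-linear convergence asks for a positive rate, but \<open>q\<close> may be \<open>0\<close> or negative\<close>
  define p where "p = max q (1 / 2)"
  have p: "0 < p" "p < 1"
    using q by (auto simp: p_def)
  have p_rate: "a (Suc k) - l \<le> p * (a k - l)" if "k \<ge> K" for k
    using rate[OF that] mult_right_mono[of q p "a k - l"] lower[of k] by (simp add: p_def)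
  have geometric: "a (j + K) - l \<le> p ^ j * (a K - l)" for j
  proof (induction j)
    case (Suc j)
    then have "p * (a (j + K) - l) \<le> p * (p ^ j * (a K - l))"
      using p by (intro mult_left_mono) auto
    then show ?case
      using p_rate[of "j + K"] by simp
  qed simp
  have p_lim: "(\<lambda>j. p ^ j * (a K - l)) \<longlonglongrightarrow> 0"
    using tendsto_mult_left_zero[OF LIMSEQ_realpow_zero, of p] p by simp
  have "(\<lambda>j. a (j + K) - l) \<longlonglongrightarrow> 0"
    by (rule real_tendsto_sandwich[OF _ _ tendsto_const p_lim]) (simp_all add: lower geometric)
  then have "a \<longlonglongrightarrow> l"
    by (rule LIMSEQ_offset[OF LIM_zero_cancel])
  moreover have "\<forall>\<^sub>F k in sequentially. dist (a (Suc k)) l \<le> p * dist (a k) l"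
    using eventually_ge_at_top[of K] by eventually_elim (simp add: p_rate dist_real_def lower)
  ultimately show ?thesis
    using p unfolding converges_Q_linearly_def by (intro conjI exI[of _ p]) auto
qed

section \<open>Estimates for a single proximal step\<close>

text \<open>The three-point inequality at \<open>y = c\<close> makes the predicted decrease at least \<open>1/2 \<parallel>z - c\<parallel>\<^sub>Q\<^sup>2\<close>. The actual
  decrease differs from the predicted one by the proximal term, which is gained, and by the model
  error, which is lost and amounts to at most \<open>L / a\<close> times the proximal term. Here \<open>m\<close> is the model of
  \<open>\<phi>\<close> at \<open>c\<close>, and \<open>a\<close> is a lower spectral bound of the metric.\<close>

lemma prox_step_estimates:
  fixes g :: "real^'m \<Rightarrow> ereal" and \<phi> m :: "real^'m \<Rightarrow> real" and Q :: "real^'m^'m"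
  defines "F \<equiv> \<lambda>v. real_of_ereal (g v) + \<phi> v" and "D \<equiv> \<lambda>v. v \<bullet> (Q *v v)"
  assumes conv: "convex (ereal_epigraph g)" and inf: "\<And>x. g x \<noteq> -\<infinity>"
    and m: "convex_on UNIV m" and sym: "transpose Q = Q"
    and lo: "\<And>v. a * (norm v)\<^sup>2 \<le> v \<bullet> (Q *v v)" and "0 < a" and "0 \<le> L"
    and min: "\<And>y. g z + ereal (m z + 1/2 * ((z - c) \<bullet> (Q *v (z - c))))
                \<le> g y + ereal (m y + 1/2 * ((y - c) \<bullet> (Q *v (y - c))))"
    and center: "m c = \<phi> c" and upper: "\<phi> z \<le> m z + L / 2 * (norm (z - c))\<^sup>2"
    and c: "g c < \<infinity>"
  shows "g z < \<infinity>"
    and "1/2 * D (z - c) \<le> F c - (real_of_ereal (g z) + m z + 1/2 * D (z - c))"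
    and "F c - (real_of_ereal (g z) + m z + 1/2 * D (z - c)) + (1 - L / a) / 2 * D (z - c) \<le> F c - F z"
    and "F z \<le> F c - (2 - L / a) / 2 * D (z - c)"
proof -
  note tp = prox_three_point[where g = g and m = m and Q = Q and z = z and c = c, OF conv inf m sym min]
  show "g z < \<infinity>"
    using tp(1) c by blast
  have "D (c - z) = D (z - c)"
    using matrix_vector_mult_scaleR[of Q "-1" "z - c"] by (simp add: D_def inner_diff)
  then show pred: "1/2 * D (z - c) \<le> F c - (real_of_ereal (g z) + m z + 1/2 * D (z - c))"
    using tp(2)[OF c] by (simp add: F_def D_def center)
  have "(norm (z - c))\<^sup>2 \<le> D (z - c) / a"
    using lo[of "z - c"] \<open>0 < a\<close> by (simp add: D_def field_simps)
  then have "L / 2 * (norm (z - c))\<^sup>2 \<le> L / 2 * (D (z - c) / a)"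
    using \<open>0 \<le> L\<close> by (intro mult_left_mono) auto
  then have *: "\<phi> z \<le> m z + L / a / 2 * D (z - c)"
    using upper by (simp add: mult_ac)
  then show act: "F c - (real_of_ereal (g z) + m z + 1/2 * D (z - c)) + (1 - L / a) / 2 * D (z - c) \<le> F c - F z"
    by (simp add: F_def diff_divide_distrib left_diff_distrib)
  show "F z \<le> F c - (2 - L / a) / 2 * D (z - c)"
    using act pred by (simp add: diff_divide_distrib left_diff_distrib)
qed

text \<open>The three-point inequality at the reference point \<open>w\<close> compares \<open>F z\<close> with \<open>F w\<close> up to the difference of
  \<open>1/2 \<parallel>w - c\<parallel>\<^sub>Q\<^sup>2\<close> and \<open>1/2 \<parallel>w - z\<parallel>\<^sub>Q\<^sup>2\<close>. With \<open>e = w - c\<close> and \<open>d = z - c\<close> this difference is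
  \<open>e \<bullet> Q d - 1/2 \<parallel>d\<parallel>\<^sub>Q\<^sup>2\<close>: the form \<open>\<parallel>e\<parallel>\<^sub>Q\<^sup>2\<close> cancels, and what remains involves \<open>e\<close> only through its Euclidean norm
  and \<open>Q d\<close>, which is exactly what the error bound relates. The cross term is the source of
  the \<open>2\<close> in \<open>2 + L'\<close>.\<close>

lemma prox_step_gap:
  fixes g :: "real^'m \<Rightarrow> ereal" and \<phi> m :: "real^'m \<Rightarrow> real" and Q :: "real^'m^'m"
  defines "F \<equiv> \<lambda>v. real_of_ereal (g v) + \<phi> v" and "D \<equiv> \<lambda>v. v \<bullet> (Q *v v)"
  assumes conv: "convex (ereal_epigraph g)" and inf: "\<And>x. g x \<noteq> -\<infinity>"
    and m: "convex_on UNIV m" and sym: "transpose Q = Q"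
    and lo: "\<And>v. a * (norm v)\<^sup>2 \<le> v \<bullet> (Q *v v)" and "0 < a" and "0 \<le> L"
    and hi: "\<And>v. v \<bullet> (Q *v v) \<le> b * (norm v)\<^sup>2" and "0 < b"
    and min: "\<And>y. g z + ereal (m z + 1/2 * ((z - c) \<bullet> (Q *v (z - c))))
                \<le> g y + ereal (m y + 1/2 * ((y - c) \<bullet> (Q *v (y - c))))"
    and upper: "\<phi> z \<le> m z + L / 2 * (norm (z - c))\<^sup>2"
    and lower: "m w \<le> \<phi> w + L' / 2 * (norm (w - c))\<^sup>2" and "0 \<le> L'"
    and w: "g w < \<infinity>"
    and error: "norm (c - w) \<le> \<kappa> * norm (Q *v (c - z))" and "1 \<le> \<kappa>"
  shows "F z - F w \<le> (b * (2 + L') * \<kappa>\<^sup>2 - (2 - L / a)) / 2 * D (z - c)"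
proof -
  define e where "e = w - c"
  define d where "d = z - c"
  define p where "p = norm (Q *v d)"
  have Qneg: "Q *v (- v) = - (Q *v v)" for v
    using matrix_vector_mult_scaleR[of Q "-1" v] by simp
  have e: "norm e \<le> \<kappa> * p"
    using error Qneg[of d] by (simp add: e_def d_def p_def norm_minus_commute)
  have D0: "0 \<le> D d"
    using lo[of d] \<open>0 < a\<close> by (smt (verit) D_def mult_nonneg_nonneg zero_le_power2)
  have p2: "p\<^sup>2 \<le> b * D d"
    unfolding p_def D_def
    by (rule norm_image_le_quadratic_form[OF sym _ hi \<open>0 < b\<close>])
      (use lo \<open>0 < a\<close> in \<open>smt (verit) mult_nonneg_nonneg zero_le_power2\<close>)
  have three_point: "real_of_ereal (g z) + m z + 1/2 * D d + 1/2 * D (e - d)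
      \<le> real_of_ereal (g w) + m w + 1/2 * D e"
    using prox_three_point(2)[where g = g and m = m and Q = Q and z = z and c = c, OF conv inf m sym min w]
    by (simp add: D_def e_def d_def)
  have "D (e - d) = D e - 2 * (e \<bullet> (Q *v d)) + D d"
    using symmetric_matrix_inner[OF sym, of d e]
    by (simp add: D_def matrix_vector_mult_diff_distrib inner_diff_left inner_diff_right)
  moreover have "e \<bullet> (Q *v d) \<le> \<kappa> * p * p"
    using norm_cauchy_schwarz[of e "Q *v d"] mult_right_mono[OF e, of p] by (simp add: p_def)
  \<comment> \<open>\<open>1 \<le> \<kappa>\<close> lets both error terms share the factor \<open>\<kappa>\<^sup>2\<close>; this is why \<open>\<kappa>\<close> is truncated below at \<open>1\<close>\<close>
  moreover have "\<kappa> * p * p \<le> \<kappa>\<^sup>2 * p\<^sup>2"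
    using mult_right_mono[of \<kappa> "\<kappa>\<^sup>2" "p\<^sup>2"] \<open>1 \<le> \<kappa>\<close>
    by (simp add: power2_eq_square mult.assoc)
  moreover have "L' / 2 * (norm e)\<^sup>2 \<le> L' / 2 * (\<kappa>\<^sup>2 * p\<^sup>2)"
    using power_mono[OF e, of 2] \<open>0 \<le> L'\<close> by (intro mult_left_mono) (auto simp: power_mult_distrib)
  moreover have "L / 2 * (norm d)\<^sup>2 \<le> L / 2 * (D d / a)"
    using lo[of d] \<open>0 < a\<close> \<open>0 \<le> L\<close> by (intro mult_left_mono) (auto simp: D_def field_simps)
  ultimately have "F z - F w \<le> \<kappa>\<^sup>2 * p\<^sup>2 + L' / 2 * (\<kappa>\<^sup>2 * p\<^sup>2) + L / 2 * (D d / a) - D d"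
    using three_point upper lower unfolding F_def e_def[symmetric] d_def[symmetric] by linarith
  also have "\<dots> = (2 + L') / 2 * \<kappa>\<^sup>2 * p\<^sup>2 - (2 - L / a) / 2 * D d"
    by (simp add: field_simps)
  also have "\<dots> \<le> (2 + L') / 2 * \<kappa>\<^sup>2 * (b * D d) - (2 - L / a) / 2 * D d"
    using p2 \<open>0 \<le> L'\<close> by (intro diff_right_mono mult_left_mono) auto
  also have "\<dots> = (b * (2 + L') * \<kappa>\<^sup>2 - (2 - L / a)) / 2 * D d"
    by (simp add: field_simps)
  finally show ?thesis
    by (simp add: d_def)
qed

section \<open>Linear convergence of the adaptive prox-convex algorithm\<close>

theorem theorem3p3:
  fixes g :: "real^'m \<Rightarrow> ereal" and h :: "real^'d \<Rightarrow> real" and C :: "real^'m \<Rightarrow> real^'d"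
    and s :: "real^'n \<Rightarrow> real" and r :: "'n \<Rightarrow> real^'m \<Rightarrow> real"
    and x0 xstar :: "real^'m"
    and L_h \<beta>_C \<beta>_s L_s L_R \<beta>_R L_U L_L :: real and L_r \<beta>_r :: "'n \<Rightarrow> real"
    and \<mu>0 \<mu>min \<alpha>1 \<alpha>2 \<nu>inc \<nu>dec \<epsilon>term :: real
    and x :: "nat \<Rightarrow> real^'m" and H :: "nat \<Rightarrow> real^'m^'m" and N :: "nat \<Rightarrow> nat"
    and \<mu> :: "nat \<Rightarrow> nat \<Rightarrow> real" and z :: "nat \<Rightarrow> nat \<Rightarrow> real^'m"
    and \<kappa> \<kappa>bar q_lo q_hi qstar :: real and U :: "(real^'m) set" and K :: nat
  assumes problem: "prox_convex_problem g h C s r"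
    (* standing assumptions *)
    and mono_smooth: "monotone_or_smooth g h C s r"
    and x0_dom: "x0 \<in> effective_dom (objective g h C s r)"
    and sublevel: "sublevel g h C s r x0 \<noteq> {}" "compact (sublevel g h C s r x0)"
    and h_lip: "L_h-lipschitz_on UNIV h"
    and C_lip: "\<forall>u v. onorm (\<lambda>w. (jacobian C (at u) - jacobian C (at v)) *v w) \<le> \<beta>_C * norm (u - v)"
    and s_lip: "\<beta>_s-lipschitz_on UNIV (grad s)"
    and r_lip: "\<forall>i. (L_r i)-lipschitz_on UNIV (r i)"
    and neg: "neg_indices g h C s r x0 \<noteq> {} \<longrightarrow>
        (\<forall>y \<in> R_map r ` {u. objective g h C s r u \<le> objective g h C s r x0}. norm (grad s y) \<le> L_s) \<and>
        (\<forall>i \<in> neg_indices g h C s r x0.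
           C1_on (r i) UNIV \<and> (\<beta>_r i)-lipschitz_on UNIV (grad (r i)))"
    (* constants; beta_R = 0 if there are no negative indices *)
    and L_R: "L_R = norm (\<chi> i. L_r i)"
    and \<beta>_R: "\<beta>_R = sqrt (\<Sum>i \<in> neg_indices g h C s r x0. (\<beta>_r i)\<^sup>2)"
    and L_U: "L_U = L_h * \<beta>_C + L_R\<^sup>2 * \<beta>_s"
    and L_L: "L_L = L_U + L_s * \<beta>_R"
    (* algorithm *)
    and params: "\<mu>0 > 0" "\<mu>min > 0" "0 < \<alpha>1" "\<alpha>1 < \<alpha>2" "\<alpha>2 < 1" "\<nu>inc > 1" "1 > \<nu>dec" "\<nu>dec > 0"
      "\<epsilon>term \<ge> 0"
    and run: "prox_convex_run g h C s r x0 \<mu>0 \<mu>min \<alpha>1 \<alpha>2 \<nu>inc \<nu>dec \<epsilon>term x H N \<mu> z"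
    (* xstar is a limit point of the iterates *)
    and limit_point: "\<exists>\<phi>. strict_mono \<phi> \<and> (x \<circ> \<phi>) \<longlonglongrightarrow> xstar"
    (* metric step-size error bound at xstar *)
    and error_bound: "\<kappa> > 0" "xstar \<in> interior U"
      "\<forall>k\<ge>K. x k \<in> U \<and>
         norm (x k - xstar) \<le> \<kappa> * norm (prox_metric (\<mu> k (N k)) (H k) *v (x k - x (Suc k)))"
    (* uniform spectral bounds, for accepted and rejected metrics *)
    and q_bounds: "0 < q_lo" "q_lo \<le> q_hi"
      "\<forall>k. \<forall>j\<le>N k. mat q_lo \<preceq>\<^sub>L prox_metric (\<mu> k j) (H k) \<and> prox_metric (\<mu> k j) (H k) \<preceq>\<^sub>L mat q_hi"
    and q_large: "q_lo > L_U / (2 - \<alpha>1)"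
    and \<kappa>bar: "\<kappa>bar = max 1 \<kappa>"
    and qstar: "qstar = 1 - min 1 ((2 - L_U / q_lo) / (q_hi * (2 + L_L) * \<kappa>bar\<^sup>2))"
  shows
    (* every trial step passes the acceptance test, so there are no rejections *)
    "(\<forall>k. N k = 0 \<and>
        (\<forall>j\<le>N k. decrease_ratio g h C s r (prox_metric (\<mu> k j) (H k)) (x k) (z k j) \<ge> ereal \<alpha>1)) \<and>
     0 \<le> qstar \<and> qstar < 1 \<and>
     xstar \<in> effective_dom (objective g h C s r) \<and>
     (\<forall>k. x k \<in> effective_dom (objective g h C s r)) \<and>
     (\<forall>k\<ge>K. objective g h C s r (x (Suc k)) - objective g h C s r xstar
         \<le> ereal qstar * (objective g h C s r (x k) - objective g h C s r xstar)) \<and>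
     converges_Q_linearly (\<lambda>k. real_of_ereal (objective g h C s r (x k)))
       (real_of_ereal (objective g h C s r xstar))"
proof -
  let ?F = "objective g h C s r"
  let ?I = "neg_indices g h C s r x0"
  define \<phi> where "\<phi> = composite_part h C s r"
  define m where "m = model_part h C s r"
  define F where "F v = real_of_ereal (g v) + \<phi> v" for v
  define Q where "Q k j = prox_metric (\<mu> k j) (H k)" for k j
  define A where "A = 2 - L_U / q_lo"
  define B where "B = q_hi * (2 + L_L) * \<kappa>bar\<^sup>2"

  have g: "\<And>v. g v \<noteq> -\<infinity>" "closed (ereal_epigraph g)" "convex (ereal_epigraph g)"
    and h_conv: "convex_on UNIV h" and C1_C: "C1_on C UNIV" and C1_s: "C1_on s UNIV"
    and r_conv: "\<And>i. convex_on UNIV (r i)"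
    using problem by (auto simp: prox_convex_problem_def proper_fun_def)
  note r_lip' = r_lip[rule_format] and C_lip' = C_lip[rule_format]

  have F_ereal: "?F v = g v + ereal (\<phi> v)" for v
    by (simp add: objective_eq \<phi>_def)
  have dom: "v \<in> effective_dom ?F \<longleftrightarrow> g v < \<infinity>" for v
    by (cases "g v") (auto simp: effective_dom_def F_ereal)
  have F: "?F v = ereal (F v)" if "g v < \<infinity>" for v
    using that g(1)[of v] by (cases "g v") (auto simp: F_ereal F_def)
  have prox: "prox_model g h C s r M c v = g v + ereal (m c v + 1/2 * ((v - c) \<bullet> (M *v (v - c))))" for M c v
    by (simp add: prox_model_eq m_def)
  have prox_finite: "prox_model g h C s r M c v
      = ereal (real_of_ereal (g v) + m c v + 1/2 * ((v - c) \<bullet> (M *v (v - c))))" if "g v < \<infinity>" for M c v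
    using that g(1)[of v] by (cases "g v") (auto simp: prox)

  \<comment> \<open>two points at distance \<open>1\<close> show that the Lipschitz constant of the Jacobian is nonnegative\<close>
  have \<beta>_C_nonneg: "0 \<le> \<beta>_C"
  proof -
    have "0 \<le> onorm (\<lambda>w. (jacobian C (at (axis undefined 1)) - jacobian C (at 0)) *v w)"
      by (rule onorm_pos_le) simp
    also have "\<dots> \<le> \<beta>_C * norm (axis undefined 1 - 0 :: real^'m)"
      by (rule C_lip')
    finally show ?thesis
      by (simp add: norm_axis_1)
  qed
  have L_U_nonneg: "0 \<le> L_U"
    using \<beta>_C_nonneg lipschitz_on_nonneg[OF h_lip] lipschitz_on_nonneg[OF s_lip] by (simp add: L_U)
  have "0 \<le> L_s * \<beta>_R"
  proof (cases "?I = {}")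
    case False
    then have "norm (grad s (R_map r x0)) \<le> L_s"
      using neg by auto
    then have "0 \<le> L_s"
      using norm_ge_zero order_trans by blast
    then show ?thesis
      by (simp add: \<beta>_R sum_nonneg)
  qed (simp add: \<beta>_R)
  then have L_L_nonneg: "0 \<le> L_L"
    using L_U_nonneg by (simp add: L_L)
  have \<alpha>1: "L_U / q_lo < 2 - \<alpha>1"
    using q_large q_bounds(1) params by (simp add: field_simps)
  then have A: "0 < A"
    using params by (simp add: A_def)
  have B: "0 < B"
    using q_bounds(1,2) L_L_nonneg by (simp add: B_def \<kappa>bar)
  have qstar': "qstar = 1 - min 1 (A / B)"
    by (simp add: qstar A_def B_def)

  have sub: "v \<in> sublevel g h C s r x0 \<longleftrightarrow> g v < \<infinity> \<and> F v \<le> F x0" for v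
    using x0_dom by (auto simp: sublevel_def dom F)

  have upper: "\<phi> v \<le> m c v + L_U / 2 * (norm (v - c))\<^sup>2" if c: "c \<in> sublevel g h C s r x0" for c v
    unfolding \<phi>_def m_def L_U L_R
  proof (rule composite_le_model[OF h_lip C1_C C_lip' C1_s s_lip r_lip' r_conv])
    fix i assume "grad s (R_map r c) $ i < 0"
    then have "i \<in> ?I"
      using c by (auto simp: neg_indices_def)
    then show "r i differentiable (at c)"
      using neg by (intro C1_on_UNIV_differentiable) auto
  qed
  have lower: "m c v \<le> \<phi> v + L_L / 2 * (norm (v - c))\<^sup>2" if c: "c \<in> sublevel g h C s r x0" for c v
    unfolding \<phi>_def m_def L_L L_U L_R \<beta>_R
  proof (rule model_le_composite[OF h_lip C1_C C_lip' C1_s s_lip r_lip'])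
    show "i \<in> ?I" if "grad s (R_map r c) $ i < 0" for i
      using that c by (auto simp: neg_indices_def)
    show "C1_on (r i) UNIV" "(\<beta>_r i)-lipschitz_on UNIV (grad (r i))" if "i \<in> ?I" for i
      using neg that by auto
    show "norm (grad s (R_map r c)) \<le> L_s" if "?I \<noteq> {}"
      using neg that c by (auto simp: sublevel_def)
  qed
  have m_conv: "convex_on UNIV (m c)" for c
    unfolding m_def by (rule convex_model_part[OF h_conv r_conv])
  have m_center: "m c c = \<phi> c" for c
    by (simp add: m_def \<phi>_def model_part_center)

  have spectral: "transpose (Q k j) = Q k j" "q_lo * (norm v)\<^sup>2 \<le> v \<bullet> (Q k j *v v)"
      "v \<bullet> (Q k j *v v) \<le> q_hi * (norm v)\<^sup>2" if "j \<le> N k" for k j v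
    using spectral_bounds[of q_lo "Q k j" q_hi] q_bounds(3) that by (auto simp: Q_def)
  have argmin: "g (z k j) + ereal (m (x k) (z k j) + 1/2 * ((z k j - x k) \<bullet> (Q k j *v (z k j - x k))))
      \<le> g y + ereal (m (x k) y + 1/2 * ((y - x k) \<bullet> (Q k j *v (y - x k))))" if "j \<le> N k" for k j y
    using run that unfolding prox_convex_run_def is_arg_min_def prox Q_def by (meson not_le)

  \<comment> \<open>Write \<open>D\<close> for the squared metric length of the trial step. Then
    \<open>Act - \<alpha>1 Pred \<ge> (1 - \<alpha>1) Pred + (1 - L_U / q_lo) / 2 D \<ge> (2 - \<alpha>1 - L_U / q_lo) / 2 D\<close>,
    which is nonnegative by the lower bound on \<open>q_lo\<close>. A run never meets the termination
    test, so \<open>Pred\<close> is not \<open>0\<close> and the ratio is a quotient of reals with positive denominator.\<close>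
  have trial: "decrease_ratio g h C s r (Q k j) (x k) (z k j) \<ge> ereal \<alpha>1
      \<and> g (z k j) < \<infinity> \<and> 0 \<le> (z k j - x k) \<bullet> (Q k j *v (z k j - x k))
      \<and> F (z k j) \<le> F (x k) - A / 2 * ((z k j - x k) \<bullet> (Q k j *v (z k j - x k)))"
    if c: "x k \<in> sublevel g h C s r x0" and j: "j \<le> N k" for k j
  proof -
    have gc: "g (x k) < \<infinity>"
      using c sub by blast
    define D where "D = (z k j - x k) \<bullet> (Q k j *v (z k j - x k))"
    define pred where "pred = F (x k) - (real_of_ereal (g (z k j)) + m (x k) (z k j) + 1/2 * D)"
    note est = prox_step_estimates[where g = g and \<phi> = \<phi> and m = "m (x k)" and Q = "Q k j" and c = "x k"
        and z = "z k j" and a = q_lo and L = L_U, OF g(3,1) m_conv spectral(1,2)[OF j] q_bounds(1)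
        L_U_nonneg argmin[OF j] m_center upper[OF c] gc, folded F_def D_def, folded pred_def]
    have D: "0 \<le> D"
      using spectral(2)[OF j, of "z k j - x k"] q_bounds(1)
      by (smt (verit) D_def mult_nonneg_nonneg zero_le_power2)
    have pred: "pred_decrease g h C s r (Q k j) (x k) (z k j) = ereal pred"
      using F[OF gc] prox_finite[OF est(1)] by (simp add: pred_decrease_def pred_def D_def)
    have "pred_decrease g h C s r (Q k j) (x k) (z k j) \<noteq> 0"
      using run j by (auto simp: prox_convex_run_def Q_def)
    with pred est(2) D have pred_pos: "0 < pred"
      by (simp add: zero_ereal_def)
    have "(1 - \<alpha>1) * (1/2 * D) \<le> (1 - \<alpha>1) * pred"
      using est(2) params by (intro mult_left_mono) auto
    moreover have "0 \<le> (2 - \<alpha>1 - L_U / q_lo) / 2 * D"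
      using \<alpha>1 D by (intro mult_nonneg_nonneg) auto
    ultimately have "\<alpha>1 * pred \<le> F (x k) - F (z k j)"
      using est(3) by (simp add: algebra_simps diff_divide_distrib add_divide_distrib)
    then have "\<alpha>1 \<le> (F (x k) - F (z k j)) / pred"
      using pred_pos by (simp add: field_simps)
    moreover have "decrease_ratio g h C s r (Q k j) (x k) (z k j) = ereal ((F (x k) - F (z k j)) / pred)"
      using pred pred_pos F[OF gc] F[OF est(1)] by (simp add: decrease_ratio_def act_decrease_def)
    ultimately show ?thesis
      using est(1,4) D by (simp add: D_def A_def)
  qed

  have x_Suc: "x (Suc k) = z k (N k)" for k
    using run by (simp add: prox_convex_run_def)
  have in_sub: "x k \<in> sublevel g h C s r x0" for k
  proof (induction k)
    case 0
    then show ?case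
      using run x0_dom by (simp add: prox_convex_run_def sub dom)
  next
    case (Suc k)
    have "F (x (Suc k)) \<le> F (x k)"
      using trial[OF Suc order_refl] A by (smt (verit) x_Suc mult_nonneg_nonneg divide_nonneg_nonneg)
    then show ?case
      using trial[OF Suc order_refl] Suc by (simp add: sub x_Suc)
  qed
  note step = trial[OF in_sub order_refl, folded x_Suc]
  have g_x: "g (x k) < \<infinity>" for k
    using in_sub sub by blast
  have accept: "N k = 0" for k
  proof (rule ccontr)
    assume "N k \<noteq> 0"
    then have "decrease_ratio g h C s r (Q k 0) (x k) (z k 0) < ereal \<alpha>1"
      using run by (auto simp: prox_convex_run_def Q_def)
    then show False
      using trial[OF in_sub, of 0 k] by (simp flip: not_le)
  qed

  have F_dec: "F (x (Suc k)) \<le> F (x k)" for k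
    using step[of k] A by (smt (verit) mult_nonneg_nonneg divide_nonneg_nonneg)
  have F_antimono: "F (x j) \<le> F (x k)" if "k \<le> j" for j k
    using lift_Suc_antimono_le[of "\<lambda>k. F (x k)", OF F_dec that] .
  obtain \<sigma> where \<sigma>: "strict_mono \<sigma>" "(x \<circ> \<sigma>) \<longlonglongrightarrow> xstar"
    using limit_point by blast
  have \<phi>_cont: "continuous_on UNIV \<phi>"
    unfolding \<phi>_def by (rule continuous_composite_part[OF h_lip C1_C C1_s r_lip'])
  \<comment> \<open>The values decrease, so for each \<open>k\<close> the tail of the convergent subsequence stays in the
    sublevel set of \<open>F (x k)\<close>; shifting it by \<open>k\<close> makes all its indices at least \<open>k\<close>.\<close>
  have F_xstar: "?F xstar \<le> ereal (F (x k))" for k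
    unfolding F_ereal
  proof (rule sublevel_limit[OF g(2) \<phi>_cont])
    show "(\<lambda>n. (x \<circ> \<sigma>) (n + k)) \<longlonglongrightarrow> xstar"
      using \<sigma>(2) by (rule LIMSEQ_ignore_initial_segment)
    show "g ((x \<circ> \<sigma>) (n + k)) + ereal (\<phi> ((x \<circ> \<sigma>) (n + k))) \<le> ereal (F (x k))" for n
      using F_antimono[of k "\<sigma> (n + k)"] seq_suble[OF \<sigma>(1), of "n + k"]
      by (simp add: F_ereal[symmetric] F[OF g_x])
  qed
  then have g_xstar: "g xstar < \<infinity>"
    using F_xstar[of 0] by (cases "g xstar") (auto simp: F_ereal)
  have lower_bound: "F xstar \<le> F (x k)" for k
    using F_xstar[of k] by (simp add: F[OF g_xstar])

  have rate: "F (x (Suc k)) - F xstar \<le> qstar * (F (x k) - F xstar)" if k: "k \<ge> K" for k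
  proof -
    have "norm (x k - xstar) \<le> \<kappa> * norm (Q k (N k) *v (x k - x (Suc k)))"
      using error_bound(3) k by (simp add: Q_def)
    also have "\<dots> \<le> \<kappa>bar * norm (Q k (N k) *v (x k - x (Suc k)))"
      by (intro mult_right_mono) (auto simp: \<kappa>bar)
    finally have "F (x (Suc k)) - F xstar
        \<le> (B - A) / 2 * ((x (Suc k) - x k) \<bullet> (Q k (N k) *v (x (Suc k) - x k)))"
      unfolding F_def A_def B_def
      using q_bounds(1,2) argmin[OF order_refl, of k, folded x_Suc]
      by (intro prox_step_gap[where m = "m (x k)"] g m_conv spectral order_refl q_bounds(1) L_U_nonneg
          L_L_nonneg upper lower in_sub g_xstar) (auto simp: \<kappa>bar)
    then show ?thesis
      unfolding qstar' using linear_rate_of_step_estimates[OF A B] step[of k] by blast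
  qed
  have q_range: "0 \<le> qstar" "qstar < 1"
    using A B by (simp_all add: qstar')
  have "converges_Q_linearly (\<lambda>k. F (x k)) (F xstar)"
    by (rule converges_Q_linearlyI[where a = "\<lambda>k. F (x k)", OF lower_bound q_range(2) rate])
  moreover have "?F (x (Suc k)) - ?F xstar \<le> ereal qstar * (?F (x k) - ?F xstar)" if "k \<ge> K" for k
    using rate[OF that] by (simp add: F[OF g_x] F[OF g_xstar])
  ultimately show ?thesis
    using accept trial[OF in_sub] q_range g_xstar g_x
    by (auto simp: dom F[OF g_x] F[OF g_xstar] Q_def)
qed

end
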